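(* Let $J_0,\ldots,J_N,H_1,\ldots,H_N\in\mathbb{R}^{n\times n}$, and for integer delays $\tau_1,\ldots,\tau_N\ge0$ with $\bar\tau=\max_i\tau_i$ consider the system $$X(k+1)=\sum_{i=0}^NJ_iX(k)J_i^T+\sum_{i=1}^NH_iX(k-\tau_i)H_i^T,\quad k\ge0,\qquad X(k)=\Xi(k),\ k\in\{-\bar\tau,\ldots,0\},\qquad(\ast)$$ with initial condition $\Xi:\{-\bar\tau,\ldots,0\}\to\mathbb{S}^n_{\succeq0}$. Define on $\mathbb{S}^n$ the operators $\mathcal{D}(X)=\sum_{i=0}^NJ_iXJ_i^T$, $\mathcal{D}^*(P)=\sum_{i=0}^NJ_i^TPJ_i$, $\mathcal{T}_i(X)=H_iXH_i^T$ and $\mathcal{T}_i^*(P)=H_i^TPH_i$. The following statements are equivalent: (a) The system $(\ast)$ is exponentially stable for any delay values $\tau_i\ge0$, $i=1,\ldots,N$. (b) The system $(\ast)$ with zero delays ($\tau_i=0$, $i=1,\ldots,N$) is exponentially stable. (c) There exist matrices $P,Q_1,\ldots,Q_N\in\mathbb{S}^n_{\succ0}$ such that $$\mathcal{D}^*(P)-P+\sum_{i=1}^NQ_i\prec0\quad\text{and}\quad\mathcal{T}_i^*(P)-Q_i\preceq0,\quad i=1,\ldots,N.$$ (d) $\mathrm{sp}\big(\mathcal{D}+\sum_{i=1}^N\mathcal{T}_i\big)\subset\mathbb{D}$, where $\mathrm{sp}\big(\mathcal{D}+\sum_i\mathcal{T}_i\big):=\{\lambda\in\mathbb{C}:\ \mathcal{D}(X)+\sum_{i=1}^N\mathcal{T}_i(X)=\lambda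 X\text{ for some }X\in\mathbb{S}^n,\ X\ne0\}$.
   Context: $\mathbb{S}^n$, $\mathbb{S}^n_{\succeq0}$, $\mathbb{S}^n_{\succ0}$ denote the real symmetric, positive semidefinite and positive definite $n\times n$ matrices; $\preceq,\prec$ refer to the Loewner order. $\mathbb{D}$ is the open unit disc of $\mathbb{C}$. For given delays, the system is exponentially stable if there exist $\beta\ge1$, $\rho\in(0,1)$ such that $\|X(k)\|\le\beta\rho^{k}\max_{s\in\{-\bar\tau,\ldots,0\}}\|\Xi(s)\|$ for all $k\ge0$ and all initial conditions $\Xi:\{-\bar\tau,\ldots,0\}\to\mathbb{S}^n_{\succeq0}$ (the constants may depend on the delays). *)

theory Defs
  imports "HOL-Analysis.Analysis"
begin

definition sym_mats :: "(real^'n^'n) set" where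
  "sym_mats = {A. transpose A = A}"

definition psd_mats :: "(real^'n^'n) set" where
  "psd_mats = {A \<in> sym_mats. \<forall>x. 0 \<le> x \<bullet> (A *v x)}"

definition pd_mats :: "(real^'n^'n) set" where
  "pd_mats = {A \<in> sym_mats. \<forall>x. x \<noteq> 0 \<longrightarrow> 0 < x \<bullet> (A *v x)}"

definition loewner_le :: "real^'n^'n \<Rightarrow> real^'n^'n \<Rightarrow> bool" where
  "loewner_le A B \<longleftrightarrow> B - A \<in> psd_mats"

definition loewner_less :: "real^'n^'n \<Rightarrow> real^'n^'n \<Rightarrow> bool" where
  "loewner_less A B \<longleftrightarrow> B - A \<in> pd_mats"

text \<open>
  The four operators below are defined on all square matrices; all of them map \<^term>\<open>sym_mats\<close>
  into itself. The families \<open>J\<close> and \<open>H\<close> are only used at the indices \<open>0..N\<close> and \<open>1..N\<close>.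
\<close>

definition op_D :: "nat \<Rightarrow> (nat \<Rightarrow> real^'n^'n) \<Rightarrow> real^'n^'n \<Rightarrow> real^'n^'n" where
  "op_D N J X = (\<Sum>i=0..N. J i ** X ** transpose (J i))"

definition op_D_adj :: "nat \<Rightarrow> (nat \<Rightarrow> real^'n^'n) \<Rightarrow> real^'n^'n \<Rightarrow> real^'n^'n" where
  "op_D_adj N J P = (\<Sum>i=0..N. transpose (J i) ** P ** J i)"

definition op_T :: "(nat \<Rightarrow> real^'n^'n) \<Rightarrow> nat \<Rightarrow> real^'n^'n \<Rightarrow> real^'n^'n" where
  "op_T H i X = H i ** X ** transpose (H i)"

definition op_T_adj :: "(nat \<Rightarrow> real^'n^'n) \<Rightarrow> nat \<Rightarrow> real^'n^'n \<Rightarrow> real^'n^'n" where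
  "op_T_adj H i P = transpose (H i) ** P ** H i"

text \<open>
  Eigenvalues are complex numbers while eigenvectors are real symmetric matrices, so the
  equation \<open>L X = z X\<close> is read in the complex matrices.
\<close>

definition sp :: "(real^'n^'n \<Rightarrow> real^'n^'n) \<Rightarrow> complex set" where
  "sp L = {z. \<exists>X \<in> sym_mats. X \<noteq> 0 \<and>
      map_matrix complex_of_real (L X) = map_matrix (\<lambda>x. z * complex_of_real x) X}"

text \<open>Delays are indexed by \<open>1..N\<close>. The inserted 0 matters only for \<open>N = 0\<close>.\<close>

definition max_delay :: "nat \<Rightarrow> (nat \<Rightarrow> nat) \<Rightarrow> nat" where
  "max_delay N \<tau> = Max (insert 0 (\<tau> ` {1..N}))"

definition init_times :: "nat \<Rightarrow> (nat \<Rightarrow> nat) \<Rightarrow> int set" where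
  "init_times N \<tau> = {- int (max_delay N \<tau>)..0}"

definition initial_condition :: "nat \<Rightarrow> (nat \<Rightarrow> nat) \<Rightarrow> (int \<Rightarrow> real^'n^'n) \<Rightarrow> bool" where
  "initial_condition N \<tau> \<Xi> \<longleftrightarrow> (\<forall>s \<in> init_times N \<tau>. \<Xi> s \<in> psd_mats)"

text \<open>Values of \<open>X\<close> and \<open>\<Xi>\<close> at times before \<open>- max_delay N \<tau>\<close> are irrelevant.\<close>

definition is_solution ::
  "nat \<Rightarrow> (nat \<Rightarrow> real^'n^'n) \<Rightarrow> (nat \<Rightarrow> real^'n^'n) \<Rightarrow> (nat \<Rightarrow> nat) \<Rightarrow>
   (int \<Rightarrow> real^'n^'n) \<Rightarrow> (int \<Rightarrow> real^'n^'n) \<Rightarrow> bool" where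
  "is_solution N J H \<tau> \<Xi> X \<longleftrightarrow>
     (\<forall>k \<in> init_times N \<tau>. X k = \<Xi> k) \<and>
     (\<forall>k \<ge> 0. X (k + 1) =
        (\<Sum>i=0..N. J i ** X k ** transpose (J i)) +
        (\<Sum>i=1..N. H i ** X (k - int (\<tau> i)) ** transpose (H i)))"

text \<open>
  \<^const>\<open>norm\<close> on matrices is the Frobenius norm. Since the constant \<open>\<beta>\<close> is existentially
  quantified and all matrix norms are equivalent, the choice does not affect the notion.
\<close>

definition exponentially_stable ::
  "nat \<Rightarrow> (nat \<Rightarrow> real^'n^'n) \<Rightarrow> (nat \<Rightarrow> real^'n^'n) \<Rightarrow> (nat \<Rightarrow> nat) \<Rightarrow> bool" where
  "exponentially_stable N J H \<tau> \<longleftrightarrow>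
     (\<exists>\<beta> \<rho> :: real. 1 \<le> \<beta> \<and> 0 < \<rho> \<and> \<rho> < 1 \<and>
       (\<forall>\<Xi> X. initial_condition N \<tau> \<Xi> \<longrightarrow> is_solution N J H \<tau> \<Xi> X \<longrightarrow>
         (\<forall>k::nat. norm (X (int k)) \<le> \<beta> * \<rho> ^ k * Max ((\<lambda>s. norm (\<Xi> s)) ` init_times N \<tau>))))"

end

theory Submission
  imports Defs
begin

text \<open>
  Put \<open>L = D + (\<Sum>i. T\<^sub>i)\<close>. The equivalences rest on the Stein inequality
  \<open>L Z \<prec> Z\<close> with \<open>Z \<succ> 0\<close>, both for \<open>L\<close> and for its adjoint, which is the operator of the
  transposed families; (c) is the Stein inequality of the adjoint, with \<open>Q\<^sub>i = T\<^sub>i\<^sup>*(P) + \<epsilon> I\<close>.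

  If the real eigenvalues of \<open>L\<close> lie in the disc, then \<open>I - t L\<close> is invertible on the symmetric
  matrices for \<open>0 \<le> t \<le> 1\<close>. The solution \<open>P\<^sub>t\<close> of \<open>P\<^sub>t - t L P\<^sub>t = I\<close> is Lipschitz in \<open>t\<close>, and it
  satisfies \<open>P\<^sub>t \<succeq> I\<close> as soon as it is positive semidefinite, so it stays positive definite up to
  \<open>t = 1\<close>; this replaces the Krein-Rutman theorem. If \<open>L Z \<prec> Z\<close>, then for \<open>\<rho> < 1\<close> close to 1
  (depending on the delays) \<open>D Z + (\<Sum>i. \<rho>\<^bsup>-\<tau>\<^sub>i\<^esup> T\<^sub>i Z) \<preceq> \<rho> Z\<close>, and \<open>X(k) \<preceq> c \<rho>\<^sup>k Z\<close> follows
  by induction. If the undelayed system is stable, \<open>L\<^sup>k Y\<close> tends to 0 for every symmetric \<open>Y\<close>; pairing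
  with an eigenvector of the adjoint bounds the eigenvalues of the adjoint. Running through this for
  \<open>L\<close> and then for its adjoint closes the cycle.
\<close>

section \<open>Semidefinite matrices\<close>

lemma scaleR_matrix_vector: "(c *\<^sub>R A) *v x = c *\<^sub>R (A *v x)"
  for A :: "real^'n^'m"
  by (simp add: scaleR_matrix_vector_assoc)

lemma transpose_add: "transpose (A + B) = transpose A + transpose B"
  by (simp add: transpose_def vec_eq_iff)

lemma transpose_diff: "transpose (A - B) = transpose A - transpose B"
  by (simp add: transpose_def vec_eq_iff)

lemma sym_mats_add: "A \<in> sym_mats \<Longrightarrow> B \<in> sym_mats \<Longrightarrow> A + B \<in> sym_mats"
  by (simp add: sym_mats_def transpose_add)

lemma sym_mats_diff: "A \<in> sym_mats \<Longrightarrow> B \<in> sym_mats \<Longrightarrow> A - B \<in> sym_mats"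
  by (simp add: sym_mats_def transpose_diff)

lemma sym_mats_scaleR: "A \<in> sym_mats \<Longrightarrow> c *\<^sub>R A \<in> sym_mats"
  by (simp add: sym_mats_def transpose_scalar)

lemma sym_mats_zero: "0 \<in> sym_mats"
  by (simp add: sym_mats_def transpose_def vec_eq_iff)

lemma sym_mats_mat: "mat c \<in> sym_mats"
  by (simp add: sym_mats_def)

lemma sym_mats_sum: "(\<And>i. i \<in> I \<Longrightarrow> A i \<in> sym_mats) \<Longrightarrow> (\<Sum>i\<in>I. A i) \<in> sym_mats"
  by (induction I rule: infinite_finite_induct) (auto simp: sym_mats_zero intro: sym_mats_add)

lemma sym_mats_congruence: "X \<in> sym_mats \<Longrightarrow> A ** X ** transpose A \<in> sym_mats"
  for A :: "real^'n^'n"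
  by (simp add: sym_mats_def matrix_transpose_mul matrix_mul_assoc)

lemma psd_mats_subset_sym: "A \<in> psd_mats \<Longrightarrow> A \<in> sym_mats"
  by (simp add: psd_mats_def)

lemma pd_mats_subset_psd: "A \<in> pd_mats \<Longrightarrow> A \<in> psd_mats"
  unfolding pd_mats_def psd_mats_def
  by (clarsimp, metis inner_zero_left less_eq_real_def)

lemma psd_mats_add: "A \<in> psd_mats \<Longrightarrow> B \<in> psd_mats \<Longrightarrow> A + B \<in> psd_mats"
  by (simp add: psd_mats_def sym_mats_add matrix_vector_mult_add_rdistrib inner_add_right)

lemma pd_mats_add_psd: "A \<in> pd_mats \<Longrightarrow> B \<in> psd_mats \<Longrightarrow> A + B \<in> pd_mats"
  by (simp add: pd_mats_def psd_mats_def sym_mats_add matrix_vector_mult_add_rdistrib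
      inner_add_right add_pos_nonneg)

lemma psd_mats_scaleR: "A \<in> psd_mats \<Longrightarrow> 0 \<le> c \<Longrightarrow> c *\<^sub>R A \<in> psd_mats"
  by (simp add: psd_mats_def sym_mats_scaleR scaleR_matrix_vector)

lemma pd_mats_scaleR: "A \<in> pd_mats \<Longrightarrow> 0 < c \<Longrightarrow> c *\<^sub>R A \<in> pd_mats"
  by (simp add: pd_mats_def sym_mats_scaleR scaleR_matrix_vector)

lemma psd_mats_zero: "0 \<in> psd_mats"
  by (simp add: psd_mats_def sym_mats_zero)

lemma psd_mats_sum: "(\<And>i. i \<in> I \<Longrightarrow> A i \<in> psd_mats) \<Longrightarrow> (\<Sum>i\<in>I. A i) \<in> psd_mats"
  by (induction I rule: infinite_finite_induct) (auto simp: psd_mats_zero intro: psd_mats_add)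

lemma pd_mats_one: "mat 1 \<in> pd_mats"
  by (simp add: pd_mats_def sym_mats_mat)

lemma psd_mats_congruence: "X \<in> psd_mats \<Longrightarrow> A ** X ** transpose A \<in> psd_mats"
  for A :: "real^'n^'n"
proof -
  assume X: "X \<in> psd_mats"
  have "x \<bullet> (A ** X ** transpose A *v x) = (transpose A *v x) \<bullet> (X *v (transpose A *v x))" for x
    by (simp only: matrix_vector_mul_assoc[symmetric] dot_lmul_matrix[symmetric]
        transpose_matrix_vector)
  with X show ?thesis
    by (simp add: psd_mats_def sym_mats_congruence del: transpose_matrix_vector)
qed

section \<open>Norm estimates for quadratic forms and margins of definiteness\<close>

lemma norm_matrix_vector_le: "norm (A *v x) \<le> norm A * norm x"
  for A :: "real^'n^'m"
proof -
  have "norm (A *v x) = L2_set (\<lambda>i. \<bar>A $ i \<bullet> x\<bar>) UNIV"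
    by (simp add: norm_vec_def matrix_vector_mul_component)
  also have "\<dots> \<le> L2_set (\<lambda>i. norm (A $ i) * norm x) UNIV"
    by (intro L2_set_mono Cauchy_Schwarz_ineq2) auto
  also have "\<dots> = norm A * norm x"
    by (simp add: norm_vec_def L2_set_left_distrib)
  finally show ?thesis .
qed

lemma quadratic_form_le_norm: "\<bar>x \<bullet> (A *v x)\<bar> \<le> norm A * (x \<bullet> x)"
  for A :: "real^'n^'n"
proof -
  have "\<bar>x \<bullet> (A *v x)\<bar> \<le> norm x * norm (A *v x)"
    by (rule Cauchy_Schwarz_ineq2)
  also have "\<dots> \<le> norm x * (norm A * norm x)"
    by (intro mult_left_mono norm_matrix_vector_le) auto
  finally show ?thesis
    by (simp add: dot_square_norm power2_eq_square mult_ac)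
qed

text \<open>By Cauchy-Schwarz the quadratic form of \<open>A\<close> is at least
  \<open>- norm A * (x \<bullet> x)\<close>. This serves to bound symmetric matrices by multiples of
  the identity and to write them as differences of positive semidefinite ones.\<close>

lemma psd_mats_shift: "A \<in> sym_mats \<Longrightarrow> norm A \<le> c \<Longrightarrow> c *\<^sub>R mat 1 + A \<in> psd_mats"
  for A :: "real^'n^'n"
proof -
  assume A: "A \<in> sym_mats" "norm A \<le> c"
  have "0 \<le> c * (x \<bullet> x) + x \<bullet> (A *v x)" for x
    using quadratic_form_le_norm[of x A] mult_right_mono[OF A(2), of "x \<bullet> x"] by simp
  with A show ?thesis
    by (simp add: psd_mats_def sym_mats_add sym_mats_scaleR sym_mats_mat inner_add_right
        matrix_vector_mult_add_rdistrib scaleR_matrix_vector)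
qed

text \<open>Adding \<open>B - A\<close> lowers the quadratic form by at most
  \<open>c * (x \<bullet> x)\<close>, which the margin of \<open>A\<close> absorbs. Both continuity
  arguments, in \<open>t\<close> and in \<open>\<rho>\<close>, use this form.\<close>

lemma psd_mats_perturb:
  fixes A B :: "real^'n^'n"
  assumes "A - c *\<^sub>R mat 1 \<in> psd_mats" "B \<in> sym_mats" "norm (B - A) \<le> c"
  shows "B \<in> psd_mats"
proof -
  have "A \<in> sym_mats"
    using sym_mats_add[OF psd_mats_subset_sym[OF assms(1)] sym_mats_scaleR[OF sym_mats_mat[of 1], of c]]
    by simp
  then have "c *\<^sub>R mat 1 + (B - A) \<in> psd_mats"
    using assms by (intro psd_mats_shift sym_mats_diff)
  from psd_mats_add[OF assms(1) this] show ?thesis by simp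
qed

text \<open>The quadratic form attains its minimum on the compact unit sphere, and the minimum is
  positive; homogeneity does the rest. Strict inequalities thereby become quantitative
  margins.\<close>

lemma pd_mats_lower_bound:
  fixes A :: "real^'n^'n"
  assumes A: "A \<in> pd_mats"
  obtains c where "c > 0" "A - c *\<^sub>R mat 1 \<in> psd_mats"
proof -
  have "continuous_on (sphere 0 1) (\<lambda>x. x \<bullet> (A *v x))"
    by (intro continuous_intros linear_continuous_on matrix_vector_mul_bounded_linear)
  then have "\<exists>u\<in>sphere 0 1. \<forall>y\<in>sphere 0 1. u \<bullet> (A *v u) \<le> y \<bullet> (A *v y)"
    by (intro continuous_attains_inf) auto
  then obtain u where u: "u \<in> sphere 0 1"
    and min: "\<And>y. y \<in> sphere 0 1 \<Longrightarrow> u \<bullet> (A *v u) \<le> y \<bullet> (A *v y)"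
    by blast
  define c where "c = u \<bullet> (A *v u)"
  have "u \<noteq> 0"
    using u by auto
  then have "c > 0"
    using A by (simp add: c_def pd_mats_def)
  moreover have "c * (x \<bullet> x) \<le> x \<bullet> (A *v x)" for x
  proof (cases "x = 0")
    case False
    define y where "y = x /\<^sub>R norm x"
    have x: "x = norm x *\<^sub>R y"
      using False by (simp add: y_def)
    have "c \<le> y \<bullet> (A *v y)"
      unfolding c_def by (rule min) (simp add: y_def False)
    then have "(norm x)\<^sup>2 * c \<le> (norm x)\<^sup>2 * (y \<bullet> (A *v y))"
      by (intro mult_left_mono) auto
    also have "\<dots> = x \<bullet> (A *v x)"
      by (subst (2 3) x)
        (simp only: matrix_vector_mult_scaleR inner_scaleR_left inner_scaleR_right
          power2_eq_square mult.assoc)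
    finally show ?thesis
      by (simp add: power2_norm_eq_inner mult.commute)
  qed simp
  then have "A - c *\<^sub>R mat 1 \<in> psd_mats"
    using A by (simp add: psd_mats_def pd_mats_def sym_mats_diff sym_mats_scaleR sym_mats_mat
        matrix_vector_mult_diff_rdistrib inner_diff_right scaleR_matrix_vector)
  ultimately show ?thesis ..
qed

text \<open>By polarization each entry of \<open>X\<close> is a difference of values of its
  quadratic form at \<open>e i + e j\<close> and \<open>e i - e j\<close>. These lie between 0 and
  \<open>c\<close> times the values for \<open>Z\<close>, so \<open>K\<close> depends on
  \<open>Z\<close> alone.\<close>

lemma psd_mats_order_interval_bounded:
  fixes Z :: "real^'n^'n"
  obtains K where "K \<ge> 0"
    "\<And>X c. 0 \<le> c \<Longrightarrow> X \<in> psd_mats \<Longrightarrow> c *\<^sub>R Z - X \<in> psd_mats \<Longrightarrow> norm X \<le> K * c"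
proof -
  define q where "q A x = x \<bullet> (A *v x)" for A :: "real^'n^'n" and x
  define e where "e i = (axis i 1 :: real^'n)" for i
  define K where "K = (\<Sum>i\<in>UNIV. \<Sum>j\<in>UNIV. \<bar>q Z (e i + e j)\<bar> + \<bar>q Z (e i - e j)\<bar>)"
  have "norm X \<le> K * c" if c: "0 \<le> c" and X: "X \<in> psd_mats" and XZ: "c *\<^sub>R Z - X \<in> psd_mats" for X c
  proof -
    have pos: "0 \<le> q X x" "q X x \<le> c * q Z x" for x
      using X XZ by (auto simp: psd_mats_def q_def matrix_vector_mult_diff_rdistrib
          inner_diff_right scaleR_matrix_vector)
    have entry: "e i \<bullet> (X *v e j) = X $ i $ j" for i j
      by (simp add: e_def inner_axis' matrix_vector_mult_basis column_def)
    have symm: "X $ i $ j = X $ j $ i" for i j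
      using X by (auto simp: psd_mats_def sym_mats_def transpose_def vec_eq_iff)
    have polar: "4 * X $ i $ j = q X (e i + e j) - q X (e i - e j)" for i j
      using symm[of i j]
      by (simp add: q_def matrix_vector_right_distrib matrix_vector_mult_diff_distrib
          inner_add_left inner_add_right inner_diff_left inner_diff_right entry)
    have bound: "\<bar>X $ i $ j\<bar> \<le> c * (\<bar>q Z (e i + e j)\<bar> + \<bar>q Z (e i - e j)\<bar>)" for i j
    proof -
      have "q X x \<le> c * \<bar>q Z x\<bar>" for x
        using pos(2)[of x] mult_left_mono[OF abs_ge_self[of "q Z x"] c] by linarith
      from this[of "e i + e j"] this[of "e i - e j"] pos(1)[of "e i + e j"] pos(1)[of "e i - e j"]
      show ?thesis
        using polar[of i j] unfolding distrib_left by linarith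
    qed
    have "norm X \<le> (\<Sum>i\<in>UNIV. norm (X $ i))"
      unfolding norm_vec_def by (rule L2_set_le_sum) simp
    also have "\<dots> \<le> (\<Sum>i\<in>UNIV. \<Sum>j\<in>UNIV. \<bar>X $ i $ j\<bar>)"
      by (intro sum_mono norm_le_l1_cart)
    also have "\<dots> \<le> (\<Sum>i\<in>UNIV. \<Sum>j\<in>UNIV. c * (\<bar>q Z (e i + e j)\<bar> + \<bar>q Z (e i - e j)\<bar>))"
      by (intro sum_mono bound)
    also have "\<dots> = K * c"
      by (simp add: K_def sum_distrib_left mult.commute)
    finally show ?thesis .
  qed
  then show ?thesis
    by (intro that[of K]) (auto simp: K_def intro!: sum_nonneg)
qed

section \<open>The Stein inequality\<close>

text \<open>Real eigenvalues \<open>r \<ge> 1\<close> are the only obstruction to the continuation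
  from \<open>t = 0\<close> to \<open>t = 1\<close>: for \<open>0 < t \<le> 1\<close> a symmetric
  kernel element of \<open>I - t L\<close> is an eigenvector of \<open>L\<close> for
  \<open>1 / t\<close>.\<close>

lemma psd_preserving_stein_solution:
  fixes L :: "real^'n^'n \<Rightarrow> real^'n^'n"
  assumes lin: "linear L"
    and sym: "\<And>X. X \<in> sym_mats \<Longrightarrow> L X \<in> sym_mats"
    and psd: "\<And>X. X \<in> psd_mats \<Longrightarrow> L X \<in> psd_mats"
    and ev: "\<And>r X. 1 \<le> r \<Longrightarrow> X \<in> sym_mats \<Longrightarrow> L X = r *\<^sub>R X \<Longrightarrow> X = 0"
  obtains Z where "Z \<in> pd_mats" "Z - L Z = mat 1"
proof -
  \<comment> \<open>Precomposing with the projection \<open>S\<close> onto the symmetric matrices removes the eigenvalues of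
     \<open>L\<close> on skew matrices, so that invertibility can be studied on the whole matrix space.\<close>
  define S :: "real^'n^'n \<Rightarrow> real^'n^'n" where "S X = (1/2) *\<^sub>R (X + transpose X)" for X
  define G where "G X = L (S X)" for X
  define M where "M t X = X - t *\<^sub>R G X" for t X
  have S_sym: "S X \<in> sym_mats" for X
    by (simp add: S_def sym_mats_def transpose_scalar transpose_add add.commute)
  have S_id: "S X = X" if "X \<in> sym_mats" for X
    using that by (simp add: S_def sym_mats_def scaleR_2[symmetric])
  have linS: "linear S"
    by (rule linearI) (simp_all add: S_def transpose_add transpose_scalar algebra_simps)
  have linG: "linear G"
    using linear_compose[OF linS lin] unfolding G_def[abs_def] o_def .
  have linM: "linear (M t)" for t
    unfolding M_def by (intro linear_compose_sub linear_id[unfolded id_def] linear_compose_scale_right linG)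
  \<comment> \<open>\<open>G\<close> takes only symmetric values, so
    \<open>X = B + t *\<^sub>R G X\<close> is symmetric; on such \<open>X\<close> the maps
    \<open>G\<close> and \<open>L\<close> agree.\<close>
  have solution_sym: "X \<in> sym_mats" if "M t X = B" "B \<in> sym_mats" for t X B
  proof -
    have "X = B + t *\<^sub>R G X"
      using that by (auto simp: M_def)
    moreover have "B + t *\<^sub>R G X \<in> sym_mats"
      unfolding G_def by (intro sym_mats_add sym_mats_scaleR sym S_sym that)
    ultimately show ?thesis by simp
  qed
  have ker: "X = 0" if t: "t \<in> {0..1}" and X: "M t X = 0" for t X
  proof -
    have "X \<in> sym_mats"
      using solution_sym[OF X sym_mats_zero] .
    then have *: "X = t *\<^sub>R L X"
      using X by (simp add: M_def G_def S_id)
    show ?thesis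
    proof (cases "t = 0")
      case False
      have "(1 / t) *\<^sub>R X = (1 / t) *\<^sub>R t *\<^sub>R L X"
        using * by simp
      with False have "L X = (1 / t) *\<^sub>R X"
        by simp
      moreover have "1 \<le> 1 / t"
        using t False by simp
      ultimately show ?thesis
        using ev \<open>X \<in> sym_mats\<close> by blast
    qed (use * in simp)
  qed
  \<comment> \<open>Compactness of \<open>{0..1} \<times> sphere 0 1\<close> makes the injectivity
    of the maps \<open>M t\<close> uniform in \<open>t\<close>.\<close>
  obtain b where b: "b > 0" "\<And>t X. t \<in> {0..1} \<Longrightarrow> b * norm X \<le> norm (M t X)"
  proof -
    let ?K = "{0..1::real} \<times> sphere (0::real^'n^'n) 1"
    have cont: "continuous_on ?K (\<lambda>p. norm (M (fst p) (snd p)))"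
      unfolding M_def
      by (intro continuous_on_norm continuous_on_diff continuous_on_scaleR continuous_on_fst
          continuous_on_id linear_continuous_on_compose[OF _ linG] continuous_on_snd)
    have "\<exists>p\<in>?K. \<forall>p'\<in>?K. norm (M (fst p) (snd p)) \<le> norm (M (fst p') (snd p'))"
      by (intro continuous_attains_inf compact_Times cont) auto
    then obtain p where p: "p \<in> ?K"
      and min: "\<And>p'. p' \<in> ?K \<Longrightarrow> norm (M (fst p) (snd p)) \<le> norm (M (fst p') (snd p'))"
      by blast
    show ?thesis
    proof (rule that)
      show "0 < norm (M (fst p) (snd p))"
        using ker[of "fst p" "snd p"] p by (auto simp: mem_Times_iff)
      fix t X assume t: "t \<in> {0..1::real}"
      show "norm (M (fst p) (snd p)) * norm X \<le> norm (M t X)"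
      proof (cases "X = 0")
        case False
        have "norm (M (fst p) (snd p)) \<le> norm (M t (X /\<^sub>R norm X))"
          using min[of "(t, X /\<^sub>R norm X)"] t False by simp
        also have "\<dots> = norm (M t X) / norm X"
          by (simp add: linear_scale[OF linM] divide_inverse mult.commute)
        finally show ?thesis
          using False by (simp add: field_simps)
      qed simp
    qed
  qed
  have "\<exists>X. M t X = mat 1" if "t \<in> {0..1}" for t
  proof -
    have "inj (M t)"
      using ker[OF that] by (simp add: linear_injective_0[OF linM])
    then have "surj (M t)"
      by (rule linear_inj_imp_surj[OF linM])
    then show ?thesis by (metis surjD)
  qed
  then obtain P where P: "\<And>t. t \<in> {0..1} \<Longrightarrow> M t (P t) = mat 1"
    by metis
  have P_sym: "P t \<in> sym_mats" if "t \<in> {0..1}" for t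
    using solution_sym[OF P[OF that] sym_mats_mat] .
  have P_eq: "P t = mat 1 + t *\<^sub>R L (P t)" if "t \<in> {0..1}" for t
    using P[OF that] S_id[OF P_sym[OF that]] by (simp add: M_def G_def algebra_simps)
  have P_bound: "norm (P t) \<le> norm (mat 1 :: real^'n^'n) / b" if "t \<in> {0..1}" for t
    using b(2)[OF that, of "P t"] b(1) P[OF that] by (simp add: field_simps)
  obtain g where g: "g > 0" "\<And>X. norm (G X) \<le> g * norm X"
    using linear_bounded_pos[OF linG] by blast
  define C where "C = g * (norm (mat 1 :: real^'n^'n) / b) / b"
  \<comment> \<open>Resolvent identity: since \<open>P s - s *\<^sub>R G (P s) = mat 1\<close>,
    applying \<open>M t\<close> to \<open>P s - P t\<close> leaves
    \<open>(s - t) *\<^sub>R G (P s)\<close>.\<close>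
  have lipschitz: "norm (P s - P t) \<le> \<bar>s - t\<bar> * C" if s: "s \<in> {0..1}" and t: "t \<in> {0..1}" for s t
  proof -
    have "M t (P s - P t) = M t (P s) - mat 1"
      using P[OF t] by (simp add: linear_diff[OF linM])
    also have "\<dots> = (s - t) *\<^sub>R G (P s)"
      using P[OF s] by (simp add: M_def algebra_simps)
    finally have "b * norm (P s - P t) \<le> \<bar>s - t\<bar> * norm (G (P s))"
      using b(2)[OF t, of "P s - P t"] by simp
    also have "\<dots> \<le> \<bar>s - t\<bar> * (g * (norm (mat 1 :: real^'n^'n) / b))"
      using g(1) by (intro mult_left_mono order_trans[OF g(2)] P_bound s) auto
    finally show ?thesis
      using b(1) by (simp add: C_def field_simps)
  qed
  \<comment> \<open>Self-improvement: mere semidefiniteness already gives a margin of 1, which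
    restores what each continuation step may lose.\<close>
  have P_ge: "P t - mat 1 \<in> psd_mats" if "t \<in> {0..1}" "P t \<in> psd_mats" for t
  proof -
    have "P t - mat 1 = t *\<^sub>R L (P t)"
      using P_eq[OF that(1)] by (simp add: diff_eq_eq add.commute)
    then show ?thesis
      using psd_mats_scaleR[OF psd[OF that(2)], of t] that(1) by simp
  qed
  obtain m :: nat where m: "C < real m" "m > 0"
  proof -
    have "0 \<le> C"
      using g(1) b(1) by (simp add: C_def)
    obtain m :: nat where "C < real m"
      using reals_Archimedean2 by blast
    moreover from this \<open>0 \<le> C\<close> have "m > 0"
      by (cases m) auto
    ultimately show ?thesis ..
  qed
  \<comment> \<open>A step of length \<open>1 / m\<close> moves \<open>P\<close> by at most
    \<open>C / m < 1\<close>, within the margin of 1, so semidefiniteness survives finitely many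
    steps up to \<open>t = 1\<close>.\<close>
  have steps: "P (real k / real m) \<in> psd_mats" if "k \<le> m" for k
    using that
  proof (induction k)
    case 0
    have "P 0 = mat 1"
      using P_eq[of 0] by simp
    then show ?case
      using pd_mats_subset_psd[OF pd_mats_one] by simp
  next
    case (Suc k)
    let ?s = "real k / real m" and ?t = "real (Suc k) / real m"
    have s: "?s \<in> {0..1}" and t: "?t \<in> {0..1}"
      using Suc.prems m by auto
    have "norm (P ?t - P ?s) \<le> \<bar>?t - ?s\<bar> * C"
      by (rule lipschitz[OF t s])
    also have "?t - ?s = 1 / real m"
      using m by (simp add: field_simps)
    also have "\<bar>1 / real m\<bar> * C \<le> 1"
      using m by (simp add: field_simps)
    finally have near: "norm (P ?t - P ?s) \<le> 1" .
    have "P ?s \<in> psd_mats"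
      using Suc by simp
    then have "P ?s - 1 *\<^sub>R mat 1 \<in> psd_mats"
      using P_ge[OF s] by simp
    then show ?case
      using P_sym[OF t] near by (rule psd_mats_perturb)
  qed
  have "P 1 \<in> psd_mats"
    using steps[of m] m by simp
  then have "mat 1 + (P 1 - mat 1) \<in> pd_mats"
    by (intro pd_mats_add_psd pd_mats_one P_ge) auto
  moreover have "P 1 - L (P 1) = mat 1"
    using P_eq[of 1] by (simp add: algebra_simps)
  ultimately show ?thesis
    using that[of "P 1"] by simp
qed

section \<open>The undelayed operator and its adjoint\<close>

text \<open>This is the operator \<open>L\<close>. Taking the families as parameters makes its
  adjoint another instance, with every \<open>J i\<close> and \<open>H i\<close> transposed, so each
  result also applies to the adjoint.\<close>

definition delay_free_op ::
  "nat \<Rightarrow> (nat \<Rightarrow> real^'n^'n) \<Rightarrow> (nat \<Rightarrow> real^'n^'n) \<Rightarrow> real^'n^'n \<Rightarrow> real^'n^'n" where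
  "delay_free_op N J H X = op_D N J X + (\<Sum>i=1..N. op_T H i X)"

lemma matrix_add_rdistrib: "(A + B) ** C = A ** C + B ** C"
  for A B :: "real^'m^'k" and C :: "real^'n^'m"
  by (simp add: vec_eq_iff matrix_matrix_mult_def sum.distrib distrib_right)

lemma linear_two_sided_mult: "linear (\<lambda>X. A ** X ** B)"
  for A B :: "real^'n^'n"
  by (rule linearI)
    (simp_all add: matrix_add_ldistrib matrix_add_rdistrib matrix_scalar_ac scalar_matrix_assoc)

lemma linear_op_D: "linear (op_D N J)"
  unfolding op_D_def[abs_def] by (intro linear_compose_sum ballI linear_two_sided_mult)

lemma linear_op_T: "linear (op_T H i)"
  unfolding op_T_def[abs_def] by (rule linear_two_sided_mult)

lemma linear_delay_free_op: "linear (delay_free_op N J H)"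
  unfolding delay_free_op_def[abs_def]
  by (intro linear_compose_add linear_compose_sum ballI linear_op_D linear_op_T)

lemma op_D_sym: "X \<in> sym_mats \<Longrightarrow> op_D N J X \<in> sym_mats"
  unfolding op_D_def by (intro sym_mats_sum sym_mats_congruence)

lemma op_T_sym: "X \<in> sym_mats \<Longrightarrow> op_T H i X \<in> sym_mats"
  unfolding op_T_def by (intro sym_mats_congruence)

lemma delay_free_op_sym: "X \<in> sym_mats \<Longrightarrow> delay_free_op N J H X \<in> sym_mats"
  unfolding delay_free_op_def by (intro sym_mats_add sym_mats_sum op_D_sym op_T_sym)

lemma op_D_psd: "X \<in> psd_mats \<Longrightarrow> op_D N J X \<in> psd_mats"
  unfolding op_D_def by (intro psd_mats_sum psd_mats_congruence)

lemma op_T_psd: "X \<in> psd_mats \<Longrightarrow> op_T H i X \<in> psd_mats"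
  unfolding op_T_def by (intro psd_mats_congruence)

lemma delay_free_op_psd: "X \<in> psd_mats \<Longrightarrow> delay_free_op N J H X \<in> psd_mats"
  unfolding delay_free_op_def by (intro psd_mats_add psd_mats_sum op_D_psd op_T_psd)

lemma op_D_transpose: "op_D N (\<lambda>i. transpose (J i)) = op_D_adj N J"
  by (simp add: fun_eq_iff op_D_def op_D_adj_def)

lemma op_T_transpose: "op_T (\<lambda>i. transpose (H i)) = op_T_adj H"
  by (simp add: fun_eq_iff op_T_def op_T_adj_def)

section \<open>Adjoints for the Frobenius inner product\<close>

lemma inner_transpose: "transpose X \<bullet> transpose Y = X \<bullet> Y"
  for X Y :: "real^'n^'m"
  unfolding inner_vec_def transpose_def by simp (rule sum.swap)

lemma inner_matrix_mult_left: "(A ** X) \<bullet> Y = X \<bullet> (transpose A ** Y)"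
  for A :: "real^'m^'k" and X :: "real^'n^'m"
proof -
  have "(A ** X) \<bullet> Y = (\<Sum>i\<in>UNIV. \<Sum>j\<in>UNIV. \<Sum>k\<in>UNIV. A $ i $ k * X $ k $ j * Y $ i $ j)"
    by (simp add: inner_vec_def matrix_matrix_mult_def sum_distrib_right)
  also have "\<dots> = (\<Sum>i\<in>UNIV. \<Sum>k\<in>UNIV. \<Sum>j\<in>UNIV. A $ i $ k * X $ k $ j * Y $ i $ j)"
    by (intro sum.cong refl sum.swap)
  also have "\<dots> = (\<Sum>k\<in>UNIV. \<Sum>i\<in>UNIV. \<Sum>j\<in>UNIV. A $ i $ k * X $ k $ j * Y $ i $ j)"
    by (rule sum.swap)
  also have "\<dots> = (\<Sum>k\<in>UNIV. \<Sum>j\<in>UNIV. \<Sum>i\<in>UNIV. A $ i $ k * X $ k $ j * Y $ i $ j)"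
    by (intro sum.cong refl sum.swap)
  also have "\<dots> = X \<bullet> (transpose A ** Y)"
    by (simp add: inner_vec_def matrix_matrix_mult_def transpose_def sum_distrib_left mult_ac)
  finally show ?thesis .
qed

lemma inner_matrix_mult_right: "(X ** B) \<bullet> Y = X \<bullet> (Y ** transpose B)"
  for B :: "real^'n^'m" and X :: "real^'m^'k"
proof -
  have "(X ** B) \<bullet> Y = (transpose B ** transpose X) \<bullet> transpose Y"
    by (metis inner_transpose matrix_transpose_mul)
  also have "\<dots> = transpose X \<bullet> (B ** transpose Y)"
    by (simp add: inner_matrix_mult_left)
  also have "\<dots> = X \<bullet> (Y ** transpose B)"
    by (metis inner_transpose matrix_transpose_mul transpose_transpose)
  finally show ?thesis .
qed

lemma inner_congruence: "(A ** X ** transpose A) \<bullet> Y = X \<bullet> (transpose A ** Y ** A)"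
  for A :: "real^'n^'n"
  unfolding inner_matrix_mult_right[where B = "transpose A"] inner_matrix_mult_left[of A X]
  by (simp add: matrix_mul_assoc)

lemma inner_delay_free_op:
  "delay_free_op N J H X \<bullet> Y
    = X \<bullet> delay_free_op N (\<lambda>i. transpose (J i)) (\<lambda>i. transpose (H i)) Y"
  by (simp add: delay_free_op_def op_D_def op_T_def inner_add_left inner_add_right inner_sum_left
      inner_sum_right inner_congruence)

text \<open>Since eigenvectors are real and nonzero, comparing one nonzero entry of \<open>X\<close>
  with that of \<open>L X\<close> shows that \<open>z\<close> is real. The complex spectrum thus
  reduces to real eigenvalues.\<close>

lemma sp_subset_disc_iff:
  "sp L \<subseteq> ball 0 1 \<longleftrightarrow> (\<forall>r. \<forall>X\<in>sym_mats. X \<noteq> 0 \<longrightarrow> L X = r *\<^sub>R X \<longrightarrow> \<bar>r\<bar> < 1)"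
proof
  assume sp: "sp L \<subseteq> ball 0 1"
  show "\<forall>r. \<forall>X\<in>sym_mats. X \<noteq> 0 \<longrightarrow> L X = r *\<^sub>R X \<longrightarrow> \<bar>r\<bar> < 1"
  proof (intro allI ballI impI)
    fix r X assume X: "X \<in> sym_mats" "X \<noteq> 0" and eq: "L X = r *\<^sub>R X"
    have "complex_of_real r \<in> sp L"
      unfolding sp_def using X by (auto intro!: bexI[of _ X] simp: eq map_matrix_def vec_eq_iff)
    then have "complex_of_real r \<in> ball 0 1"
      using sp by blast
    then show "\<bar>r\<bar> < 1" by simp
  qed
next
  assume ev: "\<forall>r. \<forall>X\<in>sym_mats. X \<noteq> 0 \<longrightarrow> L X = r *\<^sub>R X \<longrightarrow> \<bar>r\<bar> < 1"
  show "sp L \<subseteq> ball 0 1"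
  proof
    fix z assume "z \<in> sp L"
    then obtain X where X: "X \<in> sym_mats" "X \<noteq> 0"
      and eq: "\<And>i j. complex_of_real (L X $ i $ j) = z * complex_of_real (X $ i $ j)"
      by (auto simp: sp_def map_matrix_def vec_eq_iff)
    obtain i j where ij: "X $ i $ j \<noteq> 0"
      using X(2) by (auto simp: vec_eq_iff)
    define r where "r = L X $ i $ j / X $ i $ j"
    have z: "z = complex_of_real r"
      using eq[of i j] ij by (simp add: r_def field_simps)
    have "L X $ i $ j = r * X $ i $ j" for i j
      using eq[of i j] unfolding z by (metis of_real_eq_iff of_real_mult)
    then have "L X = r *\<^sub>R X"
      by (simp add: vec_eq_iff)
    with ev X z show "z \<in> ball 0 1" by auto
  qed
qed

definition stein :: "nat \<Rightarrow> (nat \<Rightarrow> real^'n^'n) \<Rightarrow> (nat \<Rightarrow> real^'n^'n) \<Rightarrow> bool" where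
  "stein N J H \<longleftrightarrow> (\<exists>Z \<in> pd_mats. Z - delay_free_op N J H Z \<in> pd_mats)"

lemma sp_imp_stein:
  assumes "sp (delay_free_op N J H) \<subseteq> ball 0 1"
  shows "stein N J H"
proof -
  have "X = 0" if "1 \<le> r" "X \<in> sym_mats" "delay_free_op N J H X = r *\<^sub>R X" for r X
    using assms that unfolding sp_subset_disc_iff by force
  then obtain Z where "Z \<in> pd_mats" "Z - delay_free_op N J H Z = mat 1"
    using psd_preserving_stein_solution[OF linear_delay_free_op delay_free_op_sym delay_free_op_psd]
    by blast
  then show ?thesis
    unfolding stein_def using pd_mats_one by metis
qed

section \<open>Stability\<close>

text \<open>Comparison argument: for some \<open>\<rho> < 1\<close> the sequence
  \<open>\<rho> ^ k *\<^sub>R Z\<close> is a supersolution of the delayed recursion, and since all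
  operators preserve the Loewner order it dominates solutions up to a constant.\<close>

lemma stein_imp_exponentially_stable:
  fixes J H :: "nat \<Rightarrow> real^'n^'n"
  assumes "stein N J H"
  shows "exponentially_stable N J H \<tau>"
proof -
  obtain Z where Z: "Z \<in> pd_mats" and W: "Z - delay_free_op N J H Z \<in> pd_mats"
    using assms by (auto simp: stein_def)
  have Z_psd: "Z \<in> psd_mats" and Z_sym: "Z \<in> sym_mats"
    using Z pd_mats_subset_psd psd_mats_subset_sym by blast+
  \<comment> \<open>Semidefiniteness of \<open>F \<rho>\<close> says that
    \<open>\<rho> powi k *\<^sub>R Z\<close> is a supersolution: looking back by
    \<open>\<tau> i\<close> costs the factor \<open>(1 / \<rho>) ^ \<tau> i\<close>. At
    \<open>\<rho> = 1\<close> this is the gap in the Stein inequality.\<close>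
  define F where
    "F \<rho> = \<rho> *\<^sub>R Z - op_D N J Z - (\<Sum>i=1..N. (1 / \<rho>) ^ \<tau> i *\<^sub>R op_T H i Z)" for \<rho> :: real
  have F1: "F 1 = Z - delay_free_op N J H Z"
    by (simp add: F_def delay_free_op_def)
  obtain w where w: "w > 0" "F 1 - w *\<^sub>R mat 1 \<in> psd_mats"
    using pd_mats_lower_bound[OF W] unfolding F1 by blast
  \<comment> \<open>\<open>F 1\<close> has the margin \<open>w\<close>, so continuity keeps
    \<open>F \<rho>\<close> positive semidefinite for some \<open>\<rho>\<close> just below 1. Its
    distance from 1 depends on the delays.\<close>
  have "(F \<longlongrightarrow> F 1) (at_left 1)"
    unfolding F_def by (intro tendsto_intros) auto
  then have "\<forall>\<^sub>F \<rho> in at_left 1. dist (F \<rho>) (F 1) < w"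
    using w(1) by (rule tendstoD)
  moreover have "\<forall>\<^sub>F \<rho> in at_left 1. \<rho> \<in> {0<..<1::real}"
    by (rule eventually_at_left_real) simp
  ultimately have "\<forall>\<^sub>F \<rho> in at_left 1. dist (F \<rho>) (F 1) < w \<and> \<rho> \<in> {0<..<1::real}"
    by (rule eventually_conj)
  from eventually_happens'[OF trivial_limit_at_left_real this]
  obtain \<rho> where "dist (F \<rho>) (F 1) < w" "\<rho> \<in> {0<..<1}"
    by blast
  then have \<rho>: "0 < \<rho>" "\<rho> < 1" and F_near: "norm (F \<rho> - F 1) \<le> w"
    by (simp_all add: dist_norm)
  have "F \<rho> \<in> sym_mats"
    unfolding F_def
    by (intro sym_mats_diff sym_mats_sum sym_mats_scaleR op_D_sym op_T_sym Z_sym)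
  then have F_psd: "F \<rho> \<in> psd_mats"
    using psd_mats_perturb[OF w(2) _ F_near] by blast
  obtain m where m: "m > 0" "Z - m *\<^sub>R mat 1 \<in> psd_mats"
    using pd_mats_lower_bound[OF Z] .
  obtain K where K: "K \<ge> 0"
    "\<And>X c. 0 \<le> c \<Longrightarrow> X \<in> psd_mats \<Longrightarrow> c *\<^sub>R Z - X \<in> psd_mats \<Longrightarrow> norm X \<le> K * c"
    using psd_mats_order_interval_bounded[of Z] by blast
  have "norm (X (int n)) \<le> max 1 (K / m) * \<rho> ^ n * Max ((\<lambda>s. norm (\<Xi> s)) ` init_times N \<tau>)"
    if init: "initial_condition N \<tau> \<Xi>" and sol: "is_solution N J H \<tau> \<Xi> X" for \<Xi> X n
  proof -
    define B where "B = Max ((\<lambda>s. norm (\<Xi> s)) ` init_times N \<tau>)"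
    have B: "norm (\<Xi> s) \<le> B" if "s \<in> init_times N \<tau>" for s
      unfolding B_def using that by (intro Max_ge) (auto simp: init_times_def)
    have "0 \<in> init_times N \<tau>"
      by (simp add: init_times_def)
    from B[OF this] have "B \<ge> 0"
      using norm_ge_zero order_trans by blast
    \<comment> \<open>As \<open>Z - m *\<^sub>R mat 1\<close> is positive semidefinite,
      \<open>c *\<^sub>R Z\<close> dominates \<open>B *\<^sub>R mat 1\<close> and hence every
      initial value.\<close>
    define c where "c = B / m"
    have c: "c \<ge> 0"
      using \<open>B \<ge> 0\<close> m(1) by (simp add: c_def)
    define dominated where
      "dominated k \<longleftrightarrow> X k \<in> psd_mats \<and> (c * \<rho> powi k) *\<^sub>R Z - X k \<in> psd_mats" for k
    have delay_le: "\<tau> i \<le> max_delay N \<tau>" if "i \<in> {1..N}" for i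
      unfolding max_delay_def using that by (intro Max_ge) auto
    have initial: "dominated k" if k: "k \<in> init_times N \<tau>" for k
    proof -
      have Xk: "X k = \<Xi> k" and psd: "\<Xi> k \<in> psd_mats"
        using sol init k by (auto simp: is_solution_def initial_condition_def)
      have "B *\<^sub>R mat 1 + (- 1) *\<^sub>R \<Xi> k \<in> psd_mats"
        using B[OF k] by (intro psd_mats_shift sym_mats_scaleR psd_mats_subset_sym psd) simp
      moreover have "c *\<^sub>R (Z - m *\<^sub>R mat 1) \<in> psd_mats"
        using m(2) c by (rule psd_mats_scaleR)
      ultimately have 1: "c *\<^sub>R Z - \<Xi> k \<in> psd_mats"
        using psd_mats_add[of "B *\<^sub>R mat 1 + (- 1) *\<^sub>R \<Xi> k" "c *\<^sub>R (Z - m *\<^sub>R mat 1)"] m(1)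
        by (simp add: c_def algebra_simps)
      \<comment> \<open>Initial times are nonpositive, so the factor \<open>\<rho> powi k\<close>
        only enlarges the bound \<open>c *\<^sub>R Z\<close>.\<close>
      have "1 \<le> \<rho> powi k"
      proof -
        have "\<rho> powi k = inverse (\<rho> ^ nat (- k))"
          using k by (simp add: init_times_def power_int_def power_inverse)
        moreover have "0 < \<rho> ^ nat (- k)" "\<rho> ^ nat (- k) \<le> 1"
          using \<rho> by (auto intro: power_le_one)
        ultimately show ?thesis
          using one_le_inverse by metis
      qed
      then have "(c * \<rho> powi k - c) *\<^sub>R Z \<in> psd_mats"
        using mult_left_mono[OF _ c, of 1 "\<rho> powi k"] by (intro psd_mats_scaleR[OF Z_psd]) simp
      from psd_mats_add[OF this 1] show ?thesis
        using psd by (simp add: dominated_def Xk algebra_simps)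
    qed
    \<comment> \<open>The induction carries all times from \<open>- max_delay N \<tau>\<close> up to
      \<open>n\<close>, because the delayed terms at the next step may reach back that far.\<close>
    have "\<forall>k. - int (max_delay N \<tau>) \<le> k \<and> k \<le> int n \<longrightarrow> dominated k" for n
    proof (induction n)
      case 0
      then show ?case
        using initial by (auto simp: init_times_def)
    next
      case (Suc n)
      have now: "dominated (int n)"
        using Suc by simp
      have past: "dominated (int n - int (\<tau> i))" if "i \<in> {1..N}" for i
        using Suc delay_le[OF that] by auto
      have rec: "X (int n + 1) = op_D N J (X (int n)) + (\<Sum>i=1..N. op_T H i (X (int n - int (\<tau> i))))"
        using sol by (simp add: is_solution_def op_D_def op_T_def)
      have "X (int n + 1) \<in> psd_mats"
        unfolding rec using now past
        by (intro psd_mats_add psd_mats_sum op_D_psd op_T_psd) (auto simp: dominated_def)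
      moreover have "(c * \<rho> powi (int n + 1)) *\<^sub>R Z - X (int n + 1) \<in> psd_mats"
      proof -
        have powi: "\<rho> powi (int n - int (\<tau> i)) = \<rho> ^ n * (1 / \<rho>) ^ \<tau> i" for i
          using \<rho>(1) by (simp add: power_int_diff power_one_over)
        have D: "op_D N J ((c * \<rho> powi int n) *\<^sub>R Z - X (int n))
            = (c * \<rho> ^ n) *\<^sub>R op_D N J Z - op_D N J (X (int n))"
          by (simp only: linear_diff[OF linear_op_D] linear_scale[OF linear_op_D] power_int_of_nat)
        have T: "op_T H i ((c * \<rho> powi (int n - int (\<tau> i))) *\<^sub>R Z - X (int n - int (\<tau> i)))
            = (c * \<rho> ^ n) *\<^sub>R (1 / \<rho>) ^ \<tau> i *\<^sub>R op_T H i Z - op_T H i (X (int n - int (\<tau> i)))" for i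
          by (simp only: linear_diff[OF linear_op_T] linear_scale[OF linear_op_T] powi
              scaleR_scaleR mult.assoc)
        have Z: "(c * \<rho> powi (int n + 1)) *\<^sub>R Z = (c * \<rho> ^ n) *\<^sub>R \<rho> *\<^sub>R Z"
          using \<rho>(1) by (simp add: power_int_add)
        \<comment> \<open>The gap at time \<open>n + 1\<close> is a multiple of
          \<open>F \<rho>\<close> plus the operators applied to the gaps at times \<open>n\<close>
          and \<open>n - \<tau> i\<close>; all these terms are positive semidefinite.\<close>
        have rearrange: "z - (d + t) = z - d' - t' + (d' - d) + (t' - t)" for z d t d' t' :: "real^'n^'n"
          by simp
        have "(c * \<rho> powi (int n + 1)) *\<^sub>R Z - X (int n + 1)
          = (c * \<rho> ^ n) *\<^sub>R F \<rho> + op_D N J ((c * \<rho> powi int n) *\<^sub>R Z - X (int n))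
            + (\<Sum>i=1..N. op_T H i ((c * \<rho> powi (int n - int (\<tau> i))) *\<^sub>R Z - X (int n - int (\<tau> i))))"
          unfolding D T Z rec F_def sum_subtractf scaleR_diff_right scaleR_sum_right
          by (rule rearrange)
        also have "\<dots> \<in> psd_mats"
          using now past c \<rho>(1)
          by (intro psd_mats_add psd_mats_sum op_D_psd op_T_psd psd_mats_scaleR[OF F_psd])
            (auto simp: dominated_def)
        finally show ?thesis .
      qed
      ultimately have "dominated (int n + 1)"
        by (simp add: dominated_def)
      show ?case
      proof (intro allI impI)
        fix k assume k: "- int (max_delay N \<tau>) \<le> k \<and> k \<le> int (Suc n)"
        show "dominated k"
        proof (cases "k = int n + 1")
          case False
          with k have "k \<le> int n" by simp
          with k Suc show ?thesis by blast
        qed (use \<open>dominated (int n + 1)\<close> in simp)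
      qed
    qed
    from this[of n] have "dominated (int n)"
      by simp
    then have "norm (X (int n)) \<le> K * (c * \<rho> ^ n)"
      using c \<rho>(1) by (intro K(2)) (auto simp: dominated_def)
    also have "\<dots> = (K / m) * (\<rho> ^ n * B)"
      by (simp add: c_def)
    \<comment> \<open>The maximum with 1 provides the required
      \<open>\<beta> \<ge> 1\<close>.\<close>
    also have "\<dots> \<le> max 1 (K / m) * (\<rho> ^ n * B)"
      using \<open>B \<ge> 0\<close> \<rho>(1) by (intro mult_right_mono) auto
    finally show ?thesis
      by (simp add: B_def mult.assoc)
  qed
  then show ?thesis
    unfolding exponentially_stable_def
    using \<rho> by (intro exI[of _ "max 1 (K / m)"] exI[of _ \<rho>]) auto
qed

text \<open>Stability speaks only of positive semidefinite initial values, whose solutions are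
  orbits of \<open>L\<close>. A symmetric \<open>Y\<close> is the difference of
  \<open>norm Y *\<^sub>R mat 1 + Y\<close> and \<open>norm Y *\<^sub>R mat 1\<close>, so linearity
  extends the convergence.\<close>

lemma zero_delay_stable_imp_iterates_tendsto_0:
  assumes stable: "exponentially_stable N J H (\<lambda>i. 0)" and Y: "Y \<in> sym_mats"
  shows "(\<lambda>k. (delay_free_op N J H ^^ k) Y) \<longlonglongrightarrow> 0"
proof -
  let ?L = "delay_free_op N J H"
  have init_times: "init_times N (\<lambda>i. 0) = {0}"
    by (auto simp: init_times_def max_delay_def image_constant_conv)
  have psd: "(\<lambda>k. (?L ^^ k) A) \<longlonglongrightarrow> 0" if A: "A \<in> psd_mats" for A
  proof -
    define X where "X k = (?L ^^ nat k) A" for k :: int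
    have "initial_condition N (\<lambda>i. 0) (\<lambda>_. A)"
      using A by (simp add: initial_condition_def)
    moreover have "is_solution N J H (\<lambda>i. 0) (\<lambda>_. A) X"
      unfolding is_solution_def init_times
      by (simp add: X_def nat_add_distrib delay_free_op_def op_D_def op_T_def)
    moreover obtain \<beta> \<rho> :: real where \<rho>: "0 < \<rho>" "\<rho> < 1" and bound:
      "\<And>\<Xi> X k. initial_condition N (\<lambda>i. 0) \<Xi> \<Longrightarrow> is_solution N J H (\<lambda>i. 0) \<Xi> X \<Longrightarrow>
        norm (X (int k)) \<le> \<beta> * \<rho> ^ k * Max ((\<lambda>s. norm (\<Xi> s)) ` init_times N (\<lambda>i. 0))"
      using stable unfolding exponentially_stable_def by blast
    ultimately have "norm ((?L ^^ k) A) \<le> \<beta> * \<rho> ^ k * norm A" for k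
      using bound[of "\<lambda>_. A" X k] by (simp add: init_times X_def)
    moreover have "(\<lambda>k. \<beta> * \<rho> ^ k * norm A) \<longlonglongrightarrow> 0"
      using LIMSEQ_power_zero[of \<rho>] \<rho> by (intro tendsto_mult_left_zero tendsto_mult_right_zero) simp
    ultimately show ?thesis
      by (rule Lim_null_comparison[OF always_eventually[OF allI]])
  qed
  have lin: "linear (?L ^^ k)" for k
  proof (induction k)
    case 0
    then show ?case
      by (simp add: id_def linear_iff)
  next
    case (Suc k)
    then show ?case
      unfolding funpow.simps by (intro linear_compose linear_delay_free_op)
  qed
  have "norm Y *\<^sub>R mat 1 \<in> psd_mats"
    by (intro psd_mats_scaleR pd_mats_subset_psd pd_mats_one) simp
  moreover have "norm Y *\<^sub>R mat 1 + Y \<in> psd_mats"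
    using Y by (intro psd_mats_shift) auto
  ultimately have "(\<lambda>k. (?L ^^ k) (norm Y *\<^sub>R mat 1 + Y) - (?L ^^ k) (norm Y *\<^sub>R mat 1)) \<longlonglongrightarrow> 0 - 0"
    by (intro tendsto_diff psd)
  then show ?thesis
    by (simp add: linear_diff[OF lin, symmetric])
qed

text \<open>If \<open>X\<close> is an eigenvector of the adjoint for \<open>r\<close>, pairing gives
  \<open>(?L ^^ k) X \<bullet> X = r ^ k * (X \<bullet> X)\<close>, which must tend to 0. Passing to
  the adjoint here leads from (b) to the Stein inequality in (c).\<close>

lemma zero_delay_stable_imp_sp_adjoint:
  assumes "exponentially_stable N J H (\<lambda>i. 0)"
  shows "sp (delay_free_op N (\<lambda>i. transpose (J i)) (\<lambda>i. transpose (H i))) \<subseteq> ball 0 1"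
  unfolding sp_subset_disc_iff
proof (intro allI ballI impI)
  fix r X
  let ?L = "delay_free_op N J H"
  assume X: "X \<in> sym_mats" "X \<noteq> 0"
    and ev: "delay_free_op N (\<lambda>i. transpose (J i)) (\<lambda>i. transpose (H i)) X = r *\<^sub>R X"
  have "(?L ^^ k) X \<bullet> X = r ^ k * (X \<bullet> X)" for k
    by (induction k) (simp_all add: inner_delay_free_op ev)
  moreover have "(\<lambda>k. (?L ^^ k) X \<bullet> X) \<longlonglongrightarrow> 0 \<bullet> X"
    by (intro tendsto_intros zero_delay_stable_imp_iterates_tendsto_0 assms X)
  ultimately have "(\<lambda>k. r ^ k * (X \<bullet> X)) \<longlonglongrightarrow> 0"
    by simp
  then have "(\<lambda>k. (r ^ k * (X \<bullet> X)) / (X \<bullet> X)) \<longlonglongrightarrow> 0"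
    by (rule tendsto_divide_zero)
  then have "(\<lambda>k. r ^ k) \<longlonglongrightarrow> 0"
    using X(2) by simp
  then have "\<forall>\<^sub>F k in sequentially. norm (r ^ k) < 1"
    using order_tendstoD(2)[OF tendsto_norm_zero] zero_less_one by blast
  then obtain k where "\<bar>r\<bar> ^ k < 1"
    by (auto simp: eventually_sequentially power_abs)
  then show "\<bar>r\<bar> < 1"
    by (meson not_less one_le_power)
qed

text \<open>Each \<open>Q i\<close> is a slack variable slightly above
  \<open>op_T_adj H i P\<close>. Conversely, summing the inequalities eliminates every
  \<open>Q i\<close>.\<close>

lemma stein_adjoint_iff:
  fixes J H :: "nat \<Rightarrow> real^'n^'n"
  shows "stein N (\<lambda>i. transpose (J i)) (\<lambda>i. transpose (H i)) \<longleftrightarrow>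
    (\<exists>P \<in> pd_mats. \<exists>Q :: nat \<Rightarrow> real^'n^'n.
      (\<forall>i \<in> {1..N}. Q i \<in> pd_mats) \<and>
      loewner_less (op_D_adj N J P - P + (\<Sum>i=1..N. Q i)) 0 \<and>
      (\<forall>i \<in> {1..N}. loewner_le (op_T_adj H i P - Q i) 0))"
    (is "_ \<longleftrightarrow> ?lmi")
proof
  assume "stein N (\<lambda>i. transpose (J i)) (\<lambda>i. transpose (H i))"
  then obtain P where P: "P \<in> pd_mats"
    and W: "P - (op_D_adj N J P + (\<Sum>i=1..N. op_T_adj H i P)) \<in> pd_mats"
    by (auto simp: stein_def delay_free_op_def op_D_transpose op_T_transpose)
  obtain w where w: "w > 0"
    "P - (op_D_adj N J P + (\<Sum>i=1..N. op_T_adj H i P)) - w *\<^sub>R mat 1 \<in> psd_mats"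
    using pd_mats_lower_bound[OF W] .
  \<comment> \<open>The margin \<open>w\<close> is cut into \<open>N + 1\<close> equal shares:
    \<open>N\<close> pay for the shifts in the matrices \<open>Q i\<close>, and the last keeps the
    first inequality strict.\<close>
  define \<epsilon> where "\<epsilon> = w / (real N + 1)"
  have \<epsilon>: "\<epsilon> > 0" "w = \<epsilon> + real N * \<epsilon>"
    using w(1) by (simp_all add: \<epsilon>_def divide_simps, simp add: algebra_simps)
  define Q where "Q i = \<epsilon> *\<^sub>R mat 1 + op_T_adj H i P" for i
  have one: "\<epsilon> *\<^sub>R mat 1 \<in> pd_mats"
    using \<epsilon>(1) by (intro pd_mats_scaleR pd_mats_one)
  have "Q i \<in> pd_mats" for i
    unfolding Q_def op_T_transpose[symmetric]
    by (intro pd_mats_add_psd one op_T_psd pd_mats_subset_psd P)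
  moreover have "loewner_less (op_D_adj N J P - P + (\<Sum>i=1..N. Q i)) 0"
  proof -
    have "(\<Sum>i=1..N. Q i) = (real N * \<epsilon>) *\<^sub>R mat 1 + (\<Sum>i=1..N. op_T_adj H i P)"
      unfolding Q_def sum.distrib sum_constant_scaleR by simp
    then show ?thesis
      using pd_mats_add_psd[OF one w(2)]
      by (simp add: loewner_less_def \<epsilon>(2) algebra_simps)
  qed
  moreover have "loewner_le (op_T_adj H i P - Q i) 0" for i
    using pd_mats_subset_psd[OF one] by (simp add: loewner_le_def Q_def)
  ultimately show ?lmi
    using P by blast
next
  assume ?lmi
  then obtain P Q where P: "P \<in> pd_mats"
    and D: "0 - (op_D_adj N J P - P + (\<Sum>i=1..N. Q i)) \<in> pd_mats"
    and T: "\<And>i. i \<in> {1..N} \<Longrightarrow> 0 - (op_T_adj H i P - Q i) \<in> psd_mats"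
    unfolding loewner_less_def loewner_le_def by blast
  have "(0 - (op_D_adj N J P - P + (\<Sum>i=1..N. Q i))) + (\<Sum>i=1..N. 0 - (op_T_adj H i P - Q i)) \<in> pd_mats"
    by (intro pd_mats_add_psd psd_mats_sum D T)
  then have "P - (op_D_adj N J P + (\<Sum>i=1..N. op_T_adj H i P)) \<in> pd_mats"
    by (simp add: sum_subtractf algebra_simps)
  with P show "stein N (\<lambda>i. transpose (J i)) (\<lambda>i. transpose (H i))"
    by (auto simp: stein_def delay_free_op_def op_D_transpose op_T_transpose)
qed

section \<open>The cycle of implications between the four statements\<close>

theorem theorem4p6:
  fixes N :: nat
    and J H :: "nat \<Rightarrow> real^'n^'n"
  defines "a \<equiv> (\<forall>\<tau> :: nat \<Rightarrow> nat. exponentially_stable N J H \<tau>)"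
    and "b \<equiv> exponentially_stable N J H (\<lambda>i. 0)"
    and "c \<equiv> (\<exists>P \<in> pd_mats. \<exists>Q :: nat \<Rightarrow> real^'n^'n.
            (\<forall>i \<in> {1..N}. Q i \<in> pd_mats) \<and>
            loewner_less (op_D_adj N J P - P + (\<Sum>i=1..N. Q i)) 0 \<and>
            (\<forall>i \<in> {1..N}. loewner_le (op_T_adj H i P - Q i) 0))"
    and "d \<equiv> sp (\<lambda>X. op_D N J X + (\<Sum>i=1..N. op_T H i X)) \<subseteq> ball 0 1"
  shows "(a \<longleftrightarrow> b) \<and> (b \<longleftrightarrow> c) \<and> (c \<longleftrightarrow> d)"
proof -
  let ?J = "\<lambda>i. transpose (J i)" and ?H = "\<lambda>i. transpose (H i)"
  have d_iff: "d \<longleftrightarrow> sp (delay_free_op N J H) \<subseteq> ball 0 1"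
    unfolding d_def delay_free_op_def[abs_def] ..
  have c_iff: "c \<longleftrightarrow> stein N ?J ?H"
    unfolding c_def by (rule stein_adjoint_iff[symmetric])
  have "a \<Longrightarrow> b"
    unfolding a_def b_def by blast
  \<comment> \<open>Stability bounds the spectrum of the adjoint, whose Stein inequality is
    (c).\<close>
  moreover have "b \<Longrightarrow> c"
    unfolding b_def c_iff by (intro sp_imp_stein zero_delay_stable_imp_sp_adjoint)
  \<comment> \<open>The Stein inequality of the adjoint makes the transposed system stable. This
    bounds the spectrum of the adjoint of the transposed operator, and transposing twice returns
    \<open>L\<close>.\<close>
  moreover have "c \<Longrightarrow> d"
    using zero_delay_stable_imp_sp_adjoint[of N ?J ?H]
    unfolding c_iff d_iff by (simp add: stein_imp_exponentially_stable)
  moreover have "d \<Longrightarrow> a"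
    unfolding a_def d_iff by (blast intro: stein_imp_exponentially_stable sp_imp_stein)
  ultimately show ?thesis by blast
qed

end
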